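(* Let $\mathcal O$ be either $\mathbb CP^2$ or $\mathcal E$ and let $\boldsymbol p$ be a non trivial irreducible unitary representation of $SU(3)$ on $\mathcal H_{\boldsymbol p}$. A symbol correspondence $W:\mathcal B(\mathcal H_{\boldsymbol p})\to C^\infty_{\mathbb C}(\mathcal O)$ is mapping-positive if and only if its operator kernel is a state, that is, if and only if its operator kernel is a positive operator.
   Context: $\mathbb CP^2\simeq SU(3)/H$, where $H=\{\mathrm{diag}(\det(U)^{-1},U):U\in U(2)\}$ is the isotropy group of $\mathrm x_0=[1:0:0]$, and $\mathcal E\simeq SU(3)/T$ is the full flag manifold, $T$ the diagonal maximal torus, $\mathrm z_0\in\mathcal E$ a point with isotropy group $T$. Write $(\boldsymbol\varsigma_0,G_0)$ for $(\mathrm x_0,H)$ or $(\mathrm z_0,T)$ according to $\mathcal O$. $\mathcal O$ has the $SU(3)$-invariant integral of total mass $1$. $\mathcal B(\mathcal H_{\boldsymbol p})$ carries the action $A^g=\rho(g)A\rho(g)^{-1}$, where $\rho$ is the irrep on $\mathcal H_{\boldsymbol p}$; $\dim(\boldsymbol p)=\dim\mathcal H_{\boldsymbol p}$. A symbol correspondence $W:\mathcal B(\mathcal H_{\boldsymbol p})\to C^\infty_{\mathbb C}(\mathcal O)$, $A\mapsto W_A$, is an injective linear map with: (1) $W_{A^g}=(W_A)^g$ for all $g\in SU(3)$, where $f^g(\boldsymbol\varsigma)=f(g^{-1}\boldsymbol\varsigma)$; (2) $W_{A^\dagger}=\overline{W_A}$; (3) $\int_{\mathcal O}W_A\,d\boldsymbol\varsigma=\operatorname{tr}(A)/\dim(\boldsymbol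 p)$. For each symbol correspondence $W$ there is a unique operator $K\in\mathcal B(\mathcal H_{\boldsymbol p})$, fixed by $G_0$, such that $W_A(g\boldsymbol\varsigma_0)=\operatorname{tr}(AK^g)$ for all $A$ and $g$; it is Hermitian with unit trace and is called the operator kernel of $W$. A state is a positive (semidefinite) operator with unit trace. $W$ is mapping-positive if it maps positive (semidefinite) operators to functions that are $\ge0$ everywhere and positive-definite operators to functions that are $>0$ everywhere. *)

theory Defs
  imports "HOL-Probability.Probability_Measure" "HOL-Library.Complex_Order"
begin

text \<open>Hermitian linear algebra on \<open>\<complex>\<^sup>n\<close>. The order on \<^typ>\<open>complex\<close> is the one of
  \<^theory>\<open>HOL-Library.Complex_Order\<close>: \<open>0 \<le> z\<close> means that \<open>z\<close> is real and nonnegative, and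
  \<open>0 < z\<close> that it is real and positive.\<close>

definition dagger :: "complex^'n^'m \<Rightarrow> complex^'m^'n" where
  "dagger A = (\<chi> i j. cnj (A $ j $ i))"

definition hprod :: "complex^'n \<Rightarrow> complex^'n \<Rightarrow> complex" where
  "hprod v w = (\<Sum>i\<in>UNIV. cnj (v $ i) * w $ i)"

definition unitary :: "complex^'n^'n \<Rightarrow> bool" where
  "unitary U \<longleftrightarrow> dagger U ** U = mat 1 \<and> U ** dagger U = mat 1"

definition positive_op :: "complex^'n^'n \<Rightarrow> bool" where
  "positive_op A \<longleftrightarrow> (\<forall>v. 0 \<le> hprod v (A *v v))"

definition positive_definite_op :: "complex^'n^'n \<Rightarrow> bool" where
  "positive_definite_op A \<longleftrightarrow> (\<forall>v. v \<noteq> 0 \<longrightarrow> 0 < hprod v (A *v v))"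

definition is_state :: "complex^'n^'n \<Rightarrow> bool" where
  "is_state A \<longleftrightarrow> positive_op A \<and> trace A = 1"


text \<open>The representation space of dimension \<open>n\<close> is identified with \<open>\<complex>\<^sup>n\<close> by means of an
  orthonormal basis, so that its operators are the complex \<open>n \<times> n\<close> matrices.\<close>

definition SU3 :: "(complex^3^3) set" where
  "SU3 = {g. unitary g \<and> det g = 1}"

definition irreducible_unitary_rep :: "(complex^3^3 \<Rightarrow> complex^'n^'n) \<Rightarrow> bool" where
  "irreducible_unitary_rep \<rho> \<longleftrightarrow>
     (\<forall>g\<in>SU3. unitary (\<rho> g)) \<and>
     (\<forall>g\<in>SU3. \<forall>h\<in>SU3. \<rho> (g ** h) = \<rho> g ** \<rho> h) \<and>
     continuous_on SU3 \<rho> \<and>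
     (\<forall>V. vec.subspace V \<and> (\<forall>g\<in>SU3. (*v) (\<rho> g) ` V \<subseteq> V) \<longrightarrow> V = {0} \<or> V = UNIV)"

definition nontrivial_rep :: "(complex^3^3 \<Rightarrow> complex^'n^'n) \<Rightarrow> bool" where
  "nontrivial_rep \<rho> \<longleftrightarrow> (\<exists>g\<in>SU3. \<rho> g \<noteq> mat 1)"

definition op_action ::
    "(complex^3^3 \<Rightarrow> complex^'n^'n) \<Rightarrow> complex^3^3 \<Rightarrow> complex^'n^'n \<Rightarrow> complex^'n^'n" where
  "op_action \<rho> g A = \<rho> g ** A ** matrix_inv (\<rho> g)"


text \<open>The two homogeneous spaces. Below, \<^const>\<open>vec.subspace\<close>, \<^const>\<open>vec.span\<close> and
  \<^const>\<open>vec.dim\<close> are taken over the complex field.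
  The isotropy group of the base point \<open>x0 = [1:0:0]\<close> consists of the block diagonal
  matrices with blocks \<open>1 / det U\<close> and \<open>U\<close>, where \<open>U\<close> ranges over \<open>U(2)\<close>.\<close>

definition CP2 :: "(complex^3) set set" where
  "CP2 = {L. vec.subspace L \<and> vec.dim L = 1}"

definition line_action :: "complex^3^3 \<Rightarrow> (complex^3) set \<Rightarrow> (complex^3) set" where
  "line_action g L = (*v) g ` L"

definition x0 :: "(complex^3) set" where
  "x0 = vec.span {axis 1 1}"

definition full_flags :: "((complex^3) set \<times> (complex^3) set) set" where
  "full_flags = {(L, P). vec.subspace L \<and> vec.subspace P \<and> L \<subseteq> P \<and> vec.dim L = 1 \<and> vec.dim P = 2}"

definition flag_action ::
    "complex^3^3 \<Rightarrow> (complex^3) set \<times> (complex^3) set \<Rightarrow> (complex^3) set \<times> (complex^3) set" where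
  "flag_action g = map_prod ((`) ((*v) g)) ((`) ((*v) g))"

definition diagonal_torus :: "(complex^3^3) set" where
  "diagonal_torus = {g \<in> SU3. \<forall>i j. i \<noteq> j \<longrightarrow> g $ i $ j = 0}"

definition isotropy_group :: "(complex^3^3 \<Rightarrow> 'o \<Rightarrow> 'o) \<Rightarrow> 'o \<Rightarrow> (complex^3^3) set" where
  "isotropy_group act b = {g \<in> SU3. act g b = b}"


fun Ck_on :: "nat \<Rightarrow> 'a::real_normed_vector set \<Rightarrow> ('a \<Rightarrow> 'b::real_normed_vector) \<Rightarrow> bool" where
  "Ck_on 0 S f \<longleftrightarrow> continuous_on S f"
| "Ck_on (Suc k) S f \<longleftrightarrow> (\<forall>x\<in>S. f differentiable at x) \<and>
     (\<forall>v. Ck_on k S (\<lambda>x. frechet_derivative f (at x) v))"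

definition smooth_on_SU3 :: "(complex^3^3 \<Rightarrow> complex) \<Rightarrow> bool" where
  "smooth_on_SU3 f \<longleftrightarrow>
     (\<forall>g\<in>SU3. \<exists>U F. open U \<and> g \<in> U \<and> (\<forall>k. Ck_on k U F) \<and> (\<forall>h\<in>U \<inter> SU3. F h = f h))"

text \<open>The smooth structure and the topology of a homogeneous space \<open>X\<close> are the quotient ones
  coming from the orbit maps \<open>g \<mapsto> g z\<close>; by transitivity, one \<open>z\<close> or all of them
  give the same condition. Functions on \<open>X\<close> are functions on the whole type of
  which only the values on \<open>X\<close> matter.\<close>

definition smooth_fun :: "(complex^3^3 \<Rightarrow> 'o \<Rightarrow> 'o) \<Rightarrow> 'o set \<Rightarrow> ('o \<Rightarrow> complex) \<Rightarrow> bool" where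
  "smooth_fun act X f \<longleftrightarrow> (\<forall>z\<in>X. smooth_on_SU3 (\<lambda>g. f (act g z)))"

definition orbit_open :: "(complex^3^3 \<Rightarrow> 'o \<Rightarrow> 'o) \<Rightarrow> 'o set \<Rightarrow> 'o set \<Rightarrow> bool" where
  "orbit_open act X U \<longleftrightarrow>
     U \<subseteq> X \<and> (\<forall>z\<in>X. openin (top_of_set SU3) {g \<in> SU3. act g z \<in> U})"

text \<open>The invariant Borel probability measure, which is unique by transitivity and compactness.\<close>

definition invariant_probability ::
    "(complex^3^3 \<Rightarrow> 'o \<Rightarrow> 'o) \<Rightarrow> 'o set \<Rightarrow> 'o measure \<Rightarrow> bool" where
  "invariant_probability act X \<mu> \<longleftrightarrow>
     prob_space \<mu> \<and> space \<mu> = X \<and> sets \<mu> = sigma_sets X {U. orbit_open act X U} \<and>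
     (\<forall>g\<in>SU3. \<forall>B\<in>sets \<mu>. emeasure \<mu> (act g ` B) = emeasure \<mu> B)"


text \<open>Here \<open>mat c ** A\<close> is the scalar multiple \<open>c A\<close>.\<close>

definition symbol_correspondence ::
    "(complex^3^3 \<Rightarrow> 'o \<Rightarrow> 'o) \<Rightarrow> 'o set \<Rightarrow> 'o measure \<Rightarrow> (complex^3^3 \<Rightarrow> complex^'n^'n)
      \<Rightarrow> (complex^'n^'n \<Rightarrow> 'o \<Rightarrow> complex) \<Rightarrow> bool" where
  "symbol_correspondence act X \<mu> \<rho> W \<longleftrightarrow>
     (\<forall>A. smooth_fun act X (W A)) \<and>
     (\<forall>A B. \<forall>z\<in>X. W (A + B) z = W A z + W B z) \<and>
     (\<forall>c A. \<forall>z\<in>X. W (mat c ** A) z = c * W A z) \<and>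
     (\<forall>A B. (\<forall>z\<in>X. W A z = W B z) \<longrightarrow> A = B) \<and>
     (\<forall>g\<in>SU3. \<forall>A. \<forall>z\<in>X. W (op_action \<rho> g A) z = W A (act (matrix_inv g) z)) \<and>
     (\<forall>A. \<forall>z\<in>X. W (dagger A) z = cnj (W A z)) \<and>
     (\<forall>A. integral\<^sup>L \<mu> (W A) = trace A / of_nat CARD('n))"

definition operator_kernel ::
    "(complex^3^3 \<Rightarrow> 'o \<Rightarrow> 'o) \<Rightarrow> 'o \<Rightarrow> (complex^3^3 \<Rightarrow> complex^'n^'n)
      \<Rightarrow> (complex^'n^'n \<Rightarrow> 'o \<Rightarrow> complex) \<Rightarrow> complex^'n^'n" where
  "operator_kernel act b \<rho> W =
     (THE K. (\<forall>g\<in>isotropy_group act b. op_action \<rho> g K = K) \<and>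
             (\<forall>A. \<forall>g\<in>SU3. W A (act g b) = trace (A ** op_action \<rho> g K)))"

definition mapping_positive :: "'o set \<Rightarrow> (complex^'n^'n \<Rightarrow> 'o \<Rightarrow> complex) \<Rightarrow> bool" where
  "mapping_positive X W \<longleftrightarrow>
     (\<forall>A. positive_op A \<longrightarrow> (\<forall>z\<in>X. 0 \<le> W A z)) \<and>
     (\<forall>A. positive_definite_op A \<longrightarrow> (\<forall>z\<in>X. 0 < W A z))"

end

theory Submission
  imports Defs
begin

text \<open>The value of \<open>W\<close> at the base point is a linear functional, hence \<open>W A b = tr (A K)\<close>, and
  equivariance turns this into \<open>W A (g b) = tr (A K\<^sup>g)\<close>. On rank one operators it says that
  \<open>W\<close> of \<open>v v\<^sup>\<dagger>\<close> at \<open>b\<close> is \<open>v\<^sup>\<dagger> K v\<close>, so a mapping-positive \<open>W\<close> has a positive kernel. Conversely, a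
  positive \<open>K\<^sup>g\<close> is a sum of operators \<open>v v\<^sup>\<dagger>\<close>, so that \<open>tr (A K\<^sup>g)\<close> is a sum of numbers \<open>v\<^sup>\<dagger> A v\<close>;
  since \<open>SU(3)\<close> acts transitively this covers every point. Transitivity also makes the symbol of
  the identity constant, and its integral yields \<open>tr K = 1\<close>, whence \<open>K \<noteq> 0\<close>.\<close>

subsection \<open>Positive operators\<close>

lemma hprod_add_right: "hprod u (v + w) = hprod u v + hprod u w"
  by (simp add: hprod_def algebra_simps sum.distrib)

lemma hprod_add_left: "hprod (u + v) w = hprod u w + hprod v w"
  by (simp add: hprod_def algebra_simps sum.distrib)

lemma hprod_scale_right: "hprod u (c *s v) = c * hprod u v"
  by (simp add: hprod_def sum_distrib_left algebra_simps)

lemma hprod_scale_left: "hprod (c *s u) v = cnj c * hprod u v"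
  by (simp add: hprod_def sum_distrib_left algebra_simps)

lemma hprod_cnj: "cnj (hprod u v) = hprod v u"
  by (simp add: hprod_def mult.commute)

lemma hprod_axis: "hprod (axis i 1) v = v $ i"
proof -
  have "hprod (axis i 1) v = (\<Sum>k\<in>UNIV. if k = i then v $ k else 0)"
    unfolding hprod_def by (rule sum.cong) (auto simp: axis_def)
  then show ?thesis by simp
qed

lemma hprod_self: "hprod v v = of_real (\<Sum>i\<in>UNIV. (cmod (v $ i))\<^sup>2)"
  unfolding hprod_def of_real_sum
  by (rule sum.cong) (simp_all only: complex_norm_square mult.commute)

lemma hprod_self_pos: "v \<noteq> 0 \<Longrightarrow> 0 < hprod v v"
proof -
  assume "v \<noteq> 0"
  then obtain i where "v $ i \<noteq> 0" by (auto simp: vec_eq_iff)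
  then have "0 < (\<Sum>i\<in>UNIV. (cmod (v $ i))\<^sup>2)"
    by (intro sum_pos2[of _ i]) auto
  then show ?thesis by (simp add: hprod_self less_complex_def del: of_real_sum)
qed

lemma matrix_mult_axis: "(A :: complex^'n^'m) *v axis i 1 = column i A"
proof -
  have "(\<Sum>j\<in>UNIV. A $ k $ j * axis i 1 $ j) = (\<Sum>j\<in>UNIV. if j = i then A $ k $ j else 0)" for k
    by (rule sum.cong) (auto simp: axis_def)
  then show ?thesis by (simp add: vec_eq_iff matrix_vector_mult_def column_def)
qed

lemma hprod_mult_right: "hprod v (A *v w) = hprod (dagger A *v v) w"
proof -
  have "hprod v (A *v w) = (\<Sum>i\<in>UNIV. \<Sum>j\<in>UNIV. cnj (v $ i) * (A $ i $ j * w $ j))"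
    by (simp add: hprod_def matrix_vector_mult_def sum_distrib_left)
  also have "\<dots> = (\<Sum>j\<in>UNIV. \<Sum>i\<in>UNIV. cnj (v $ i) * (A $ i $ j * w $ j))"
    by (rule sum.swap)
  also have "\<dots> = hprod (dagger A *v v) w"
    by (simp add: hprod_def matrix_vector_mult_def dagger_def sum_distrib_left sum_distrib_right algebra_simps)
  finally show ?thesis .
qed

lemma dagger_dagger [simp]: "dagger (dagger A) = A"
  by (simp add: dagger_def vec_eq_iff)

section \<open>Rank one operators and the decomposition of positive operators\<close>

definition outer :: "complex^'n \<Rightarrow> complex^'n^'n" where
  "outer v = (\<chi> i j. v $ i * cnj (v $ j))"

lemma outer_mult: "outer v *v w = hprod v w *s v"
  by (simp add: outer_def hprod_def matrix_vector_mult_def vec_eq_iff sum_distrib_left sum_distrib_right algebra_simps)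

text \<open>The bridge between the trace pairing and quadratic forms: it tests the kernel on rank
  one operators, and it evaluates the pairing once the kernel is decomposed into such
  operators.\<close>

lemma trace_mult_outer: "trace (A ** outer v) = hprod v (A *v v)"
  by (simp add: trace_def outer_def hprod_def matrix_vector_mult_def matrix_matrix_mult_def
      sum_distrib_left algebra_simps)

lemma positive_outer: "positive_op (outer v)"
proof -
  have "hprod w (hprod v w *s v) = of_real ((cmod (hprod v w))\<^sup>2)" for w
    by (simp only: hprod_scale_right complex_norm_square hprod_cnj)
  then show ?thesis by (simp add: positive_op_def outer_mult less_eq_complex_def del: of_real_power)
qed

lemma sesquilinear_expand:
  fixes K :: "complex^'n^'n"
  shows "hprod (a *s v + w) (K *v (a *s v + w)) =
    a * cnj a * hprod v (K *v v) + cnj a * hprod v (K *v w) + a * hprod w (K *v v) + hprod w (K *v w)"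
  by (simp add: matrix_vector_right_distrib vector_scalar_commute hprod_add_left hprod_add_right
      hprod_scale_left hprod_scale_right algebra_simps)

text \<open>Polarization: the quadratic form takes real values, so expanding it at
  \<open>v + w\<close> and at \<open>\<i> *s v + w\<close> shows that the two mixed terms have
  opposite imaginary parts and equal real parts.\<close>

lemma positive_hermitian:
  assumes "positive_op K"
  shows "hprod w (K *v v) = cnj (hprod v (K *v w))"
proof -
  have real: "Im (hprod u (K *v u)) = 0" for u
    using assms by (simp add: positive_op_def less_eq_complex_def)
  have "Im (hprod v (K *v w) + hprod w (K *v v)) = 0"
    using real[of "1 *s v + w"] real[of v] real[of w] unfolding sesquilinear_expand by simp
  moreover have "Im (cnj \<i> * hprod v (K *v w) + \<i> * hprod w (K *v v)) = 0"
    using real[of "\<i> *s v + w"] real[of v] real[of w] unfolding sesquilinear_expand by simp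
  ultimately show ?thesis by (simp add: complex_eq_iff)
qed

lemma positive_diagonal_zero:
  assumes "positive_op K" and diag: "\<And>i. K $ i $ i = 0"
  shows "K = 0"
proof -
  have "K $ i $ j = 0" for i j
  proof -
    let ?z = "K $ i $ j"
    have entry: "hprod (axis k 1) (K *v axis l 1) = K $ k $ l" for k l
      by (simp add: hprod_axis matrix_mult_axis column_def)
    have "K $ j $ i = cnj ?z"
      using positive_hermitian[OF assms(1), of "axis j 1" "axis i 1"] by (simp only: entry)
    \<comment> \<open>With a vanishing diagonal only the mixed terms survive; the coefficient
      \<open>- ?z\<close> makes both equal to minus the squared modulus of
      \<open>?z\<close>.\<close>
    moreover have "0 \<le> hprod ((- ?z) *s axis i 1 + axis j 1) (K *v ((- ?z) *s axis i 1 + axis j 1))"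
      using assms(1) by (simp only: positive_op_def)
    ultimately have "0 \<le> - (2 * (?z * cnj ?z))"
      unfolding sesquilinear_expand entry diag by (simp add: algebra_simps)
    then have "(cmod ?z)\<^sup>2 \<le> 0"
      by (simp add: less_eq_complex_def flip: complex_norm_square of_real_power)
    then show ?thesis by simp
  qed
  then show ?thesis by (simp add: vec_eq_iff)
qed

text \<open>The Cholesky decomposition, by elimination of one diagonal entry at a time.\<close>

lemma positive_eq_sum_outer:
  fixes K :: "complex^'n^'n"
  assumes "positive_op K"
  shows "\<exists>vs. K = sum_list (map outer vs)"
  using assms
proof (induction "card {i. K $ i $ i \<noteq> 0}" arbitrary: K rule: less_induct)
  case less
  show ?case
  proof (cases "\<forall>i. K $ i $ i = 0")
    case True
    then have "K = sum_list (map outer [])"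
      using positive_diagonal_zero[OF less.prems] by simp
    then show ?thesis by blast
  next
    case False
    then obtain i where i: "K $ i $ i \<noteq> 0" by blast
    define e :: "complex^'n" where "e = axis i 1"
    define k where "k = K $ i $ i"
    have entry: "hprod (axis l 1) (M *v axis m 1) = M $ l $ m" for l m and M :: "complex^'n^'n"
      by (simp add: hprod_axis matrix_mult_axis column_def)
    have kq: "k = hprod e (K *v e)" by (simp add: e_def k_def entry)
    have "0 \<le> k" using less.prems by (simp add: kq positive_op_def)
    with i have k: "0 < k" "Im k = 0" "0 < Re k" "k \<noteq> 0"
      by (auto simp: k_def less_eq_complex_def less_complex_def complex_eq_iff)
    \<comment> \<open>The scaling makes \<open>outer w\<close> equal to
      \<open>K e e\<^sup>\<dagger> K / k\<close>, so that \<open>M\<close> is the Schur complement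
      of the pivot \<open>k\<close>, padded with a zero row and column.\<close>
    define c where "c = complex_of_real (1 / sqrt (Re k))"
    have cc: "c * cnj c = 1 / k"
      using k by (simp add: c_def complex_eq_iff Re_divide Im_divide power2_eq_square flip: of_real_mult)
    define w where "w = c *s (K *v e)"
    define M where "M = K - outer w"
    have qM: "hprod v (M *v v) = hprod v (K *v v) - hprod v (K *v e) * hprod e (K *v v) / k" for v
    proof -
      have "hprod v (outer w *v v) = hprod w v * hprod v w"
        by (simp add: outer_mult hprod_scale_right)
      also have "\<dots> = (c * cnj c) * (hprod v (K *v e) * cnj (hprod v (K *v e)))"
        by (simp add: w_def hprod_scale_right hprod_scale_left hprod_cnj)
      also have "cnj (hprod v (K *v e)) = hprod e (K *v v)"
        using positive_hermitian[OF less.prems] by metis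
      finally have "hprod v (outer w *v v) = hprod v (K *v e) * hprod e (K *v v) / k"
        by (simp add: cc)
      moreover have "hprod v (M *v v) + hprod v (outer w *v v) = hprod v (K *v v)"
        by (simp add: M_def matrix_vector_mult_diff_rdistrib flip: hprod_add_right)
      ultimately show ?thesis by (simp add: algebra_simps)
    qed
    have pos: "positive_op M"
      unfolding positive_op_def
    proof
      fix v
      \<comment> \<open>Completing the square: this \<open>a\<close> minimizes the form of
        \<open>K\<close> at \<open>a *s e + v\<close>, and the minimum is the form of
        \<open>M\<close> at \<open>v\<close>.\<close>
      define a where "a = - hprod e (K *v v) / k"
      have cnja: "cnj a = - hprod v (K *v e) / k"
        using k positive_hermitian[OF less.prems, of v e]
        by (simp add: a_def complex_eq_iff Re_divide Im_divide)
      have "0 \<le> hprod (a *s e + v) (K *v (a *s e + v))"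
        using less.prems by (simp only: positive_op_def)
      also have "\<dots> = hprod v (M *v v)"
        unfolding sesquilinear_expand qM cnja using k by (simp add: a_def flip: kq)
      finally show "0 \<le> hprod v (M *v v)" .
    qed
    have "M $ i $ i = 0"
      using qM[of e] k by (simp add: e_def entry k_def)
    \<comment> \<open>No new nonzero diagonal entry appears: \<open>M $ j $ j\<close> and the
      nonnegative entry of \<open>outer w\<close> add up to zero. Together with the cleared entry at
      \<open>i\<close> this makes the induction measure drop.\<close>
    moreover have "M $ j $ j = 0" if "K $ j $ j = 0" for j
    proof -
      have "M $ j $ j + outer w $ j $ j = 0"
        using that by (simp add: M_def)
      moreover have "0 \<le> M $ j $ j" "0 \<le> outer w $ j $ j"
        using pos positive_outer[of w] by (metis positive_op_def entry)+
      ultimately show ?thesis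
        by (simp add: less_eq_complex_def complex_eq_iff)
    qed
    ultimately have "{j. M $ j $ j \<noteq> 0} \<subset> {j. K $ j $ j \<noteq> 0}"
      using i by auto
    then obtain vs where "M = sum_list (map outer vs)"
      using less.hyps pos by (meson finite psubset_card_mono)
    then have "K = sum_list (map outer (w # vs))"
      by (simp add: M_def algebra_simps)
    then show ?thesis by blast
  qed
qed

section \<open>The trace pairing of positive operators\<close>

lemma trace_mult_sum_outer:
  "trace (A ** sum_list (map outer vs)) = (\<Sum>v\<leftarrow>vs. hprod v (A *v v))"
  by (induction vs) (simp_all add: matrix_add_ldistrib trace_add trace_mult_outer,
    simp add: trace_def matrix_matrix_mult_def)

lemma trace_positive_mult:
  assumes "positive_op A" and "positive_op K"
  shows "0 \<le> trace (A ** K)"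
proof -
  obtain vs where vs: "K = sum_list (map outer vs)"
    using positive_eq_sum_outer[OF assms(2)] by blast
  have "0 \<le> (\<Sum>v\<leftarrow>vs. hprod v (A *v v))"
    using assms(1) by (intro sum_list_nonneg) (auto simp: positive_op_def)
  then show ?thesis by (simp add: vs trace_mult_sum_outer)
qed

lemma positive_definite_imp_positive: "positive_definite_op A \<Longrightarrow> positive_op A"
  unfolding positive_definite_op_def positive_op_def
  \<comment> \<open>Only \<open>v = 0\<close> needs an argument; there additivity forces
    \<open>hprod 0 w = 0\<close>.\<close>
  by (metis hprod_add_left add_0 add_cancel_left_left order.refl less_imp_le)

text \<open>Since \<open>K \<noteq> 0\<close>, some vector of its decomposition is nonzero. Its term
  is strictly positive, and no other term is negative.\<close>

lemma trace_positive_definite_mult: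
  assumes "positive_definite_op A" and "positive_op K" and "K \<noteq> 0"
  shows "0 < trace (A ** K)"
proof -
  obtain vs where vs: "K = sum_list (map outer vs)"
    using positive_eq_sum_outer[OF assms(2)] by blast
  have nonneg: "0 \<le> hprod v (A *v v)" for v
    using positive_definite_imp_positive[OF assms(1)] by (simp add: positive_op_def)
  have "0 < (\<Sum>v\<leftarrow>us. hprod v (A *v v))" if "sum_list (map outer us) \<noteq> 0" for us
    using that
  proof (induction us)
    case (Cons u us)
    have rest: "0 \<le> (\<Sum>v\<leftarrow>us. hprod v (A *v v))"
      by (intro sum_list_nonneg) (auto simp: nonneg)
    show ?case
    proof (cases "u = 0")
      case True
      then have "outer u = 0" by (simp add: outer_def vec_eq_iff)
      then show ?thesis using Cons nonneg[of u] by (simp add: add_nonneg_pos)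
    next
      case False
      then have "0 < hprod u (A *v u)" using assms(1) by (simp add: positive_definite_op_def)
      then show ?thesis using rest by (simp add: add_pos_nonneg)
    qed
  qed simp
  then show ?thesis using assms(3) by (simp add: vs trace_mult_sum_outer)
qed

text \<open>\<open>matrix_inv\<close> is a choice among two-sided inverses, so its value is known
  only through their uniqueness.\<close>

lemma matrix_inverse_unique:
  fixes A B :: "complex^'n^'n"
  assumes "A ** B = mat 1" and "B ** A = mat 1"
  shows "matrix_inv A = B"
proof -
  have "A ** matrix_inv A = mat 1 \<and> matrix_inv A ** A = mat 1"
    unfolding matrix_inv_def by (rule someI[of _ B]) (simp add: assms)
  then show ?thesis
    by (metis assms(2) matrix_mul_assoc matrix_mul_lid matrix_mul_rid)
qed

lemma unitary_inverse: "unitary U \<Longrightarrow> matrix_inv U = dagger U"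
  by (rule matrix_inverse_unique) (simp_all add: unitary_def)

text \<open>The inverse of \<open>U\<close> is its adjoint, so the form of the conjugate at
  \<open>v\<close> is the form of \<open>K\<close> at \<open>dagger U *v v\<close>.\<close>

lemma positive_conjugate:
  assumes "unitary U" and "positive_op K"
  shows "positive_op (U ** K ** matrix_inv U)"
  unfolding positive_op_def
proof
  fix v
  have "hprod v ((U ** K ** matrix_inv U) *v v) = hprod (dagger U *v v) (K *v (dagger U *v v))"
    by (simp add: unitary_inverse[OF assms(1)] hprod_mult_right[of v U] flip: matrix_vector_mul_assoc)
  then show "0 \<le> hprod v ((U ** K ** matrix_inv U) *v v)"
    using assms(2) by (simp add: positive_op_def)
qed

lemma dagger_mult: "dagger (A ** B) = dagger B ** dagger A"
  by (simp add: dagger_def matrix_matrix_mult_def vec_eq_iff mult.commute)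

subsection \<open>The operator kernel\<close>

lemma mat_1_in_SU3: "mat 1 \<in> SU3"
proof -
  have "dagger (mat 1 :: complex^3^3) = mat 1"
    by (auto simp: dagger_def mat_def vec_eq_iff)
  then show ?thesis by (simp add: SU3_def unitary_def)
qed

lemma SU3_mult:
  assumes "g \<in> SU3" and "h \<in> SU3"
  shows "g ** h \<in> SU3"
proof -
  have "dagger h ** dagger g ** (g ** h) = dagger h ** (dagger g ** g) ** h"
    "g ** h ** (dagger h ** dagger g) = g ** (h ** dagger h) ** dagger g"
    by (simp_all add: matrix_mul_assoc)
  then show ?thesis
    using assms by (simp add: SU3_def unitary_def det_mul dagger_mult)
qed

lemma SU3_inverse:
  assumes "g \<in> SU3"
  shows "matrix_inv g \<in> SU3" and "g ** matrix_inv g = mat 1" and "matrix_inv g ** g = mat 1"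
    and "matrix_inv (matrix_inv g) = g"
proof -
  have inv: "matrix_inv g = dagger g" "dagger g ** g = mat 1" "g ** dagger g = mat 1" "det g = 1"
    using assms by (auto simp: SU3_def unitary_inverse) (simp_all add: unitary_def)
  then have "det (dagger g) = 1"
    using det_mul[of "dagger g" g] by simp
  with inv show "matrix_inv g \<in> SU3" "g ** matrix_inv g = mat 1" "matrix_inv g ** g = mat 1"
    by (simp_all add: SU3_def unitary_def)
  from inv show "matrix_inv (matrix_inv g) = g"
    by (simp add: matrix_inverse_unique)
qed

text \<open>Nondegeneracy of the trace pairing, by testing on matrix units. It yields both the
  invariance and the uniqueness of the kernel.\<close>

lemma trace_mult_eq_imp_eq:
  fixes K M :: "complex^'n^'n"
  assumes "\<And>A. trace (A ** K) = trace (A ** M)"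
  shows "K = M"
proof -
  have "trace ((\<chi> k l. if k = i then axis j 1 $ l else 0) ** N) = N $ j $ i"
    for i j and N :: "complex^'n^'n"
  proof -
    have "trace ((\<chi> k l. if k = i then axis j 1 $ l else 0) ** N)
        = (\<Sum>k\<in>UNIV. if k = i then \<Sum>l\<in>UNIV. axis j 1 $ l * N $ l $ k else 0)"
      unfolding trace_def matrix_matrix_mult_def by (rule sum.cong) auto
    also have "\<dots> = (\<Sum>l\<in>UNIV. axis j 1 $ l * N $ l $ i)"
      by simp
    also have "\<dots> = (\<Sum>l\<in>UNIV. if l = j then N $ l $ i else 0)"
      by (rule sum.cong) (auto simp: axis_def)
    finally show ?thesis by simp
  qed
  then show ?thesis using assms by (metis vec_eq_iff)
qed

text \<open>A linear functional is determined by its values on the matrix units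
  \<open>E i j\<close>. These values are the entries of \<open>K\<close>, transposed because
  \<open>A $ i $ j\<close> meets \<open>K $ j $ i\<close> in the trace.\<close>

lemma linear_functional_eq_trace:
  fixes \<phi> :: "complex^'n^'n \<Rightarrow> complex"
  assumes add: "\<And>A B. \<phi> (A + B) = \<phi> A + \<phi> B" and scale: "\<And>c A. \<phi> (mat c ** A) = c * \<phi> A"
  shows "\<exists>K. \<forall>A. \<phi> A = trace (A ** K)"
proof -
  define E :: "'n \<Rightarrow> 'n \<Rightarrow> complex^'n^'n" where
    "E i j = (\<chi> k l. if k = i \<and> l = j then 1 else 0)" for i j
  have zero: "\<phi> 0 = 0" using add[of 0 0] by simp
  have sum: "\<phi> (sum f S) = (\<Sum>s\<in>S. \<phi> (f s))" if "finite S" for f :: "'n \<Rightarrow> _" and S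
    using that by (induction rule: finite_induct) (simp_all add: add zero)
  have "\<phi> A = trace (A ** (\<chi> j i. \<phi> (E i j)))" for A
  proof -
    have "A = (\<Sum>i\<in>UNIV. \<Sum>j\<in>UNIV. mat (A $ i $ j) ** E i j)"
    proof -
      have "(\<Sum>i\<in>UNIV. \<Sum>j\<in>UNIV. (mat (A $ i $ j) ** E i j) $ k $ l) = A $ k $ l" for k l
      proof -
        have "(mat (A $ i $ j) ** E i j) $ k $ l = (if j = l then if i = k then A $ k $ l else 0 else 0)" for i j
        proof -
          have "(mat (A $ i $ j) ** E i j) $ k $ l = (\<Sum>m\<in>UNIV. if m = k then A $ i $ j * E i j $ k $ l else 0)"
            by (simp add: matrix_matrix_mult_def mat_def if_distrib if_distribR cong: if_cong)
          then show ?thesis by (auto simp: E_def)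
        qed
        then show ?thesis by simp
      qed
      then show ?thesis by (simp add: vec_eq_iff)
    qed
    then have "\<phi> A = \<phi> (\<Sum>i\<in>UNIV. \<Sum>j\<in>UNIV. mat (A $ i $ j) ** E i j)"
      by (rule arg_cong)
    also have "\<dots> = (\<Sum>i\<in>UNIV. \<Sum>j\<in>UNIV. A $ i $ j * \<phi> (E i j))"
      by (simp add: sum scale)
    finally show ?thesis by (simp add: trace_def matrix_matrix_mult_def)
  qed
  then show ?thesis by blast
qed

text \<open>\<open>\<rho> (mat 1)\<close> is idempotent by multiplicativity and invertible by
  unitarity, hence the identity; inverses are then preserved.\<close>

lemma rep_inverse:
  assumes "irreducible_unitary_rep \<rho>" and "g \<in> SU3"
  shows "\<rho> (mat 1) = mat 1" and "matrix_inv (\<rho> g) = \<rho> (matrix_inv g)"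
proof -
  have unit: "unitary (\<rho> h)" if "h \<in> SU3" for h
    using assms(1) that by (simp add: irreducible_unitary_rep_def)
  have hom: "\<rho> (h ** k) = \<rho> h ** \<rho> k" if "h \<in> SU3" "k \<in> SU3" for h k
    using assms(1) that by (simp add: irreducible_unitary_rep_def)
  show one: "\<rho> (mat 1) = mat 1"
    using hom[OF mat_1_in_SU3 mat_1_in_SU3] unit[OF mat_1_in_SU3]
    by (metis matrix_mul_assoc matrix_mul_lid unitary_def)
  show "matrix_inv (\<rho> g) = \<rho> (matrix_inv g)"
    using SU3_inverse[OF assms(2)] hom assms(2) one by (metis matrix_inverse_unique)
qed

lemma trace_conjugate:
  fixes U :: "complex^'n^'n"
  assumes "unitary U"
  shows "trace (U ** K ** matrix_inv U) = trace K"
proof -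
  have "trace (U ** K ** matrix_inv U) = trace (matrix_inv U ** U ** K)"
    by (subst trace_mul_sym) (simp add: matrix_mul_assoc)
  then show ?thesis
    using assms by (simp add: unitary_inverse unitary_def)
qed

text \<open>Stated for an abstract transitive action with a base point, so that lines and flags are
  both instances.\<close>

lemma mapping_positive_iff_kernel:
  fixes \<rho> :: "complex^3^3 \<Rightarrow> complex^'n^'n" and act :: "complex^3^3 \<Rightarrow> 'o \<Rightarrow> 'o"
  assumes rep: "irreducible_unitary_rep \<rho>"
    and b: "b \<in> X" "act (mat 1) b = b"
    and transitive: "\<And>z. z \<in> X \<Longrightarrow> \<exists>g\<in>SU3. z = act g b"
    and \<mu>: "invariant_probability act X \<mu>"
    and W: "symbol_correspondence act X \<mu> \<rho> W"
  shows "mapping_positive X W \<longleftrightarrow> is_state (operator_kernel act b \<rho> W)"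
    and "mapping_positive X W \<longleftrightarrow> positive_op (operator_kernel act b \<rho> W)"
proof -
  have unit: "unitary (\<rho> g)" if "g \<in> SU3" for g
    using rep that by (simp add: irreducible_unitary_rep_def)
  have "\<exists>K. \<forall>A. W A b = trace (A ** K)"
    by (rule linear_functional_eq_trace) (use W b(1) in \<open>auto simp: symbol_correspondence_def\<close>)
  then obtain K where K: "\<And>A. W A b = trace (A ** K)" by blast
  have equivariant: "W (op_action \<rho> g A) z = W A (act (matrix_inv g) z)"
    if "g \<in> SU3" "z \<in> X" for g A z
    using W that by (simp add: symbol_correspondence_def)
  \<comment> \<open>Equivariance moves \<open>g\<close> from the point to the operator
    \<open>A\<close>, and cyclicity of the trace moves it on to \<open>K\<close>.\<close>
  have orbit: "W A (act g b) = trace (A ** op_action \<rho> g K)" if g: "g \<in> SU3" for A g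
  proof -
    have "W A (act g b) = W (op_action \<rho> (matrix_inv g) A) b"
      using equivariant[OF SU3_inverse(1)[OF g] b(1), of A] by (simp add: SU3_inverse(4)[OF g])
    also have "\<dots> = trace (\<rho> (matrix_inv g) ** (A ** \<rho> g ** K))"
      using SU3_inverse[OF g] rep_inverse(2)[OF rep, of "matrix_inv g"]
      by (simp add: K op_action_def matrix_mul_assoc)
    also have "\<dots> = trace (A ** \<rho> g ** K ** \<rho> (matrix_inv g))"
      by (rule trace_mul_sym)
    also have "\<dots> = trace (A ** op_action \<rho> g K)"
      by (simp only: op_action_def matrix_mul_assoc rep_inverse(2)[OF rep g])
    finally show ?thesis .
  qed
  have fixed: "op_action \<rho> g K = K" if "g \<in> isotropy_group act b" for g
  proof (rule trace_mult_eq_imp_eq)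
    fix A
    show "trace (A ** op_action \<rho> g K) = trace (A ** K)"
      using that orbit[of g A] by (simp add: isotropy_group_def K)
  qed
  have kernel: "operator_kernel act b \<rho> W = K"
    unfolding operator_kernel_def
  proof (rule the_equality)
    fix M
    assume M: "(\<forall>g\<in>isotropy_group act b. op_action \<rho> g M = M) \<and>
      (\<forall>A. \<forall>g\<in>SU3. W A (act g b) = trace (A ** op_action \<rho> g M))"
    \<comment> \<open>The identity lies in the isotropy group, so the trace formula at
      \<open>g = mat 1\<close> reads \<open>W A b = trace (A ** M)\<close>, which determines
      \<open>M\<close>.\<close>
    then have "op_action \<rho> (mat 1) M = M"
      using b(2) mat_1_in_SU3 by (simp add: isotropy_group_def)
    then show "M = K"
      using M mat_1_in_SU3 b(2) K by (metis trace_mult_eq_imp_eq)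
  qed (use fixed orbit in blast)
  have "trace K = 1"
  proof -
    have "W (mat 1) z = trace K" if "z \<in> X" for z
      using transitive[OF that] orbit unit by (auto simp: op_action_def trace_conjugate)
    moreover have "space \<mu> = X" "prob_space \<mu>"
      using \<mu> by (simp_all add: invariant_probability_def)
    ultimately have "integral\<^sup>L \<mu> (W (mat 1)) = integral\<^sup>L \<mu> (\<lambda>_. trace K)"
      by (intro Bochner_Integration.integral_cong) auto
    also have "\<dots> = trace K"
      using \<open>prob_space \<mu>\<close> by (simp add: prob_space.prob_space)
    \<comment> \<open>The trace of the identity cancels the dimension in the normalization of the
      integral.\<close>
    also have "integral\<^sup>L \<mu> (W (mat 1)) = 1"
      using W by (simp add: symbol_correspondence_def trace_I)
    finally show ?thesis by simp
  qed
  have "positive_op K" if "mapping_positive X W"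
    unfolding positive_op_def
  proof
    fix v
    have "0 \<le> W (outer v) b"
      using that b(1) positive_outer[of v] unfolding mapping_positive_def by blast
    then show "0 \<le> hprod v (K *v v)"
      by (metis K trace_mul_sym trace_mult_outer)
  qed
  moreover have "mapping_positive X W" if "positive_op K"
  proof -
    have pos: "positive_op (op_action \<rho> g K)" if "g \<in> SU3" for g
      using \<open>positive_op K\<close> positive_conjugate unit[OF that] by (simp add: op_action_def)
    \<comment> \<open>Strict positivity of the symbols of positive-definite operators needs a
      nonzero \<open>K\<^sup>g\<close>; conjugation preserves the trace, which is
      \<open>1\<close>.\<close>
    have "op_action \<rho> g K \<noteq> 0" if "g \<in> SU3" for g
    proof
      assume "op_action \<rho> g K = 0"
      then have "trace K = trace (0 :: complex^'n^'n)"
        using trace_conjugate[OF unit[OF that], of K] by (simp add: op_action_def)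
      then show False using \<open>trace K = 1\<close> by (simp add: trace_def)
    qed
    then show ?thesis
      unfolding mapping_positive_def
      by (auto dest!: transitive simp: orbit pos trace_positive_mult trace_positive_definite_mult)
  qed
  ultimately show "mapping_positive X W \<longleftrightarrow> is_state (operator_kernel act b \<rho> W)"
    and "mapping_positive X W \<longleftrightarrow> positive_op (operator_kernel act b \<rho> W)"
    unfolding kernel is_state_def using \<open>trace K = 1\<close> by blast+
qed

subsection \<open>Transitivity of the actions\<close>

lemma normalize:
  assumes "(v :: complex^'n) \<noteq> 0"
  shows "\<exists>c. c \<noteq> 0 \<and> hprod (c *s v) (c *s v) = 1"
proof -
  define r where "r = (\<Sum>i\<in>UNIV. (cmod (v $ i))\<^sup>2)"
  have v: "hprod v v = of_real r" by (simp only: hprod_self r_def)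
  then have "0 < r" using hprod_self_pos[OF assms] by (simp add: less_complex_def)
  define c where "c = complex_of_real (1 / sqrt r)"
  have "c * cnj c * of_real r = 1"
    using \<open>0 < r\<close> by (simp add: c_def flip: of_real_mult)
  then have "hprod (c *s v) (c *s v) = 1"
    by (simp add: hprod_scale_left hprod_scale_right v algebra_simps)
  moreover have "c \<noteq> 0" using \<open>0 < r\<close> by (simp add: c_def)
  ultimately show ?thesis by blast
qed

text \<open>The third column is the conjugated cross product of the first two; Lagrange's identity
  gives both its norm and the determinant.\<close>

lemma orthonormal_pair_in_SU3:
  fixes u v :: "complex^3"
  assumes "hprod u u = 1" and "hprod v v = 1" and "hprod u v = 0"
  shows "\<exists>g\<in>SU3. column 1 g = u \<and> column 2 g = v"
proof -
  define a b c where "a = u $ 2 * v $ 3 - u $ 3 * v $ 2" and "b = u $ 3 * v $ 1 - u $ 1 * v $ 3"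
    and "c = u $ 1 * v $ 2 - u $ 2 * v $ 1"
  define g :: "complex^3^3" where
    "g = vector [vector [u $ 1, v $ 1, cnj a], vector [u $ 2, v $ 2, cnj b], vector [u $ 3, v $ 3, cnj c]]"
  have uu: "cnj (u $ 1) * u $ 1 + cnj (u $ 2) * u $ 2 + cnj (u $ 3) * u $ 3 = 1"
    and vv: "cnj (v $ 1) * v $ 1 + cnj (v $ 2) * v $ 2 + cnj (v $ 3) * v $ 3 = 1"
    and uv: "cnj (u $ 1) * v $ 1 + cnj (u $ 2) * v $ 2 + cnj (u $ 3) * v $ 3 = 0"
    using assms by (simp_all add: hprod_def sum_3)
  have vu: "cnj (v $ 1) * u $ 1 + cnj (v $ 2) * u $ 2 + cnj (v $ 3) * u $ 3 = 0"
    using arg_cong[OF uv, of cnj] by (simp add: mult.commute)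
  have norm: "a * cnj a + b * cnj b + c * cnj c = 1"
  \<comment> \<open>Lagrange's identity is polynomial once the conjugates of the coordinates are
    treated as independent variables.\<close>
  proof -
    have "a * cnj a + b * cnj b + c * cnj c =
      (cnj (u $ 1) * u $ 1 + cnj (u $ 2) * u $ 2 + cnj (u $ 3) * u $ 3) *
      (cnj (v $ 1) * v $ 1 + cnj (v $ 2) * v $ 2 + cnj (v $ 3) * v $ 3) -
      (cnj (u $ 1) * v $ 1 + cnj (u $ 2) * v $ 2 + cnj (u $ 3) * v $ 3) *
      (cnj (v $ 1) * u $ 1 + cnj (v $ 2) * u $ 2 + cnj (v $ 3) * u $ 3)"
      unfolding a_def b_def c_def complex_cnj_diff complex_cnj_mult by algebra
    then show ?thesis by (simp only: uu vv uv) simp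
  qed
  have orth: "a * u $ 1 + b * u $ 2 + c * u $ 3 = 0" "a * v $ 1 + b * v $ 2 + c * v $ 3 = 0"
    by (simp_all add: a_def b_def c_def algebra_simps)
  have orth': "cnj (u $ 1) * cnj a + cnj (u $ 2) * cnj b + cnj (u $ 3) * cnj c = 0"
    "cnj (v $ 1) * cnj a + cnj (v $ 2) * cnj b + cnj (v $ 3) * cnj c = 0"
    by (simp_all add: a_def b_def c_def algebra_simps)
  have "dagger g ** g = mat 1"
    using uu vv uv vu norm orth orth'
    by (simp add: vec_eq_iff forall_3 dagger_def matrix_matrix_mult_def sum_3 mat_def g_def)
  moreover from this have "g ** dagger g = mat 1"
    using matrix_left_right_inverse by blast
  \<comment> \<open>Expansion along the third column gives the left side of
    \<open>norm\<close>.\<close>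
  moreover have "det g = 1"
    unfolding norm[symmetric] by (simp add: det_3 g_def a_def b_def c_def algebra_simps)
  ultimately have "g \<in> SU3" by (simp add: SU3_def unitary_def)
  moreover have "column 1 g = u" "column 2 g = v"
    by (simp_all add: vec_eq_iff forall_3 column_def g_def)
  ultimately show ?thesis by blast
qed

text \<open>Gram-Schmidt: subtracting from \<open>p\<close> its projection on \<open>u\<close>
  leaves \<open>q \<noteq> 0\<close> orthogonal to \<open>u\<close>. The normalized \<open>u\<close>
  and \<open>q\<close> are the first two columns of some \<open>g\<close>, that is, the images of
  the first two axes, and they have the same spans as \<open>u\<close> and
  \<open>u, p\<close>.\<close>

lemma SU3_moves_to_span:
  fixes u p :: "complex^3"
  assumes u: "u \<noteq> 0" and p: "p \<notin> vec.span {u}"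
  shows "\<exists>g\<in>SU3. vec.span {u} = (*v) g ` vec.span {axis 1 1} \<and>
    vec.span {u, p} = (*v) g ` vec.span {axis 1 1, axis 2 1}"
proof -
  define k where "k = hprod u p / hprod u u"
  define q where "q = p + (- k) *s u"
  have "q \<noteq> 0"
  proof
    assume "q = 0"
    then have "p = k *s u" by (simp add: q_def)
    then show False using p by (metis vec.span_base vec.span_scale singletonI)
  qed
  have uu: "hprod u u \<noteq> 0" using hprod_self_pos[OF u] by simp
  then have uq: "hprod u q = 0"
    unfolding q_def hprod_add_right hprod_scale_right by (simp add: k_def)
  obtain c where c: "c \<noteq> 0" "hprod (c *s u) (c *s u) = 1" using normalize[OF u] by blast
  obtain d where d: "d \<noteq> 0" "hprod (d *s q) (d *s q) = 1" using normalize[OF \<open>q \<noteq> 0\<close>] by blast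
  have "hprod (c *s u) (d *s q) = 0" by (simp add: hprod_scale_left hprod_scale_right uq)
  then obtain g where g: "g \<in> SU3" "column 1 g = c *s u" "column 2 g = d *s q"
    using orthonormal_pair_in_SU3[OF c(2) d(2)] by blast
  have image: "(*v) g ` vec.span S = vec.span ((*v) g ` S)" for S
    by (simp add: vec.span_image)
  have u_eq: "u = inverse c *s (c *s u)" using c(1) by simp
  have p_eq: "p = inverse d *s (d *s q) + (k * inverse c) *s (c *s u)"
    using c(1) d(1) by (simp add: q_def algebra_simps)
  have "c *s u \<in> vec.span {u}" by (simp add: vec.span_base vec.span_scale)
  moreover have "u \<in> vec.span {c *s u}"
    by (subst u_eq) (intro vec.span_scale vec.span_base, simp)
  ultimately have "vec.span {u} = vec.span {c *s u}"
    by (simp add: vec.span_eq)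
  moreover have "vec.span {u, p} = vec.span {c *s u, d *s q}"
  proof -
    have "c *s u \<in> vec.span {u, p}" "d *s q \<in> vec.span {u, p}"
      unfolding q_def by (intro vec.span_add vec.span_scale vec.span_base; simp)+
    moreover have "u \<in> vec.span {c *s u, d *s q}"
      by (subst u_eq) (intro vec.span_scale vec.span_base, simp)
    moreover have "p \<in> vec.span {c *s u, d *s q}"
      by (subst p_eq) (intro vec.span_add vec.span_scale vec.span_base; simp)
    ultimately show ?thesis by (simp add: vec.span_eq)
  qed
  ultimately show ?thesis
    using g by (intro bexI[of _ g]) (simp_all add: image matrix_mult_axis)
qed

lemma dim_1_eq_span:
  assumes "vec.subspace L" and "vec.dim L = 1"
  obtains u :: "complex^'n" where "u \<noteq> 0" and "L = vec.span {u}"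
proof -
  have "\<not> L \<subseteq> {0}" using assms(2) vec.dim_eq_0[of L] by simp
  then obtain u where u: "u \<in> L" "u \<noteq> 0" by blast
  have "vec.span {u} = L"
    using assms u by (intro vec.subspace_dim_equal vec.span_minimal) auto
  then show thesis using that u(2) by metis
qed

text \<open>A generator \<open>u\<close> of \<open>L\<close> and any \<open>p\<close> in
  \<open>P\<close> outside \<open>L\<close> span a plane inside \<open>P\<close>, hence
  \<open>P\<close> itself by dimension. Transitivity on flags and on lines both rest on
  this.\<close>

lemma full_flag_eq_image:
  assumes "(L, P) \<in> full_flags"
  shows "\<exists>g\<in>SU3. (L, P) = flag_action g (vec.span {axis 1 1}, vec.span {axis 1 1, axis 2 1})"
proof -
  have LP: "vec.subspace L" "vec.subspace P" "L \<subseteq> P" "vec.dim L = 1" "vec.dim P = 2"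
    using assms by (auto simp: full_flags_def)
  obtain u where u: "u \<noteq> 0" "L = vec.span {u}" using dim_1_eq_span LP by metis
  have "L \<noteq> P" using LP by auto
  then obtain p where p: "p \<in> P" "p \<notin> L" using LP by blast
  have "u \<in> P" using u(2) LP(3) by (auto intro: vec.span_base)
  then have "vec.span {p, u} = P"
    using LP p u by (intro vec.subspace_dim_equal vec.span_minimal) (auto simp: vec.dim_insert)
  then show ?thesis
    using SU3_moves_to_span[OF u(1), of p] u(2) p(2) by (simp add: flag_action_def insert_commute)
qed

text \<open>Lets transitivity on lines be read off from that on flags.\<close>

lemma line_extends_to_flag:
  assumes "L \<in> CP2"
  shows "\<exists>P. (L, P) \<in> full_flags"
proof -
  have L: "vec.subspace L" "vec.dim L = 1" using assms by (auto simp: CP2_def)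
  then obtain u where u: "u \<noteq> 0" "L = vec.span {u}" using dim_1_eq_span by metis
  have "vec.dim (UNIV :: (complex^3) set) = 3" by (subst vec_dim_card) simp
  with L(2) obtain p where p: "p \<notin> L" by (metis UNIV_eq_I numeral_eq_one_iff num.distinct(3))
  have "(L, vec.span {p, u}) \<in> full_flags"
    using L u p by (auto simp: full_flags_def vec.dim_insert intro: vec.span_mono[THEN subsetD])
  then show ?thesis by blast
qed

section \<open>Transitivity on flags and lines\<close>

lemma flag_action_comp: "flag_action (g ** h) z = flag_action g (flag_action h z)"
  by (cases z) (simp add: flag_action_def image_image matrix_vector_mul_assoc)

lemma flag_action_one: "flag_action (mat 1) z = z"
  by (cases z) (simp add: flag_action_def)

lemma flag_action_transitive:
  assumes "z \<in> full_flags" and "z0 \<in> full_flags"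
  shows "\<exists>g\<in>SU3. z = flag_action g z0"
proof -
  let ?s = "(vec.span {axis 1 1}, vec.span {axis 1 1, axis 2 1}) :: (complex^3) set \<times> (complex^3) set"
  obtain g h where g: "g \<in> SU3" "z = flag_action g ?s" and h: "h \<in> SU3" "z0 = flag_action h ?s"
    using assms full_flag_eq_image by (metis surj_pair)
  \<comment> \<open>The base flag is arbitrary: \<open>matrix_inv h\<close> takes it to the standard
    flag, and \<open>g\<close> takes that to \<open>z\<close>.\<close>
  have "z = flag_action (g ** matrix_inv h) z0"
    using SU3_inverse(3)[OF h(1)] g(2) h(2)
    by (simp add: flag_action_one flip: flag_action_comp matrix_mul_assoc)
  then show ?thesis using SU3_mult SU3_inverse(1) g(1) h(1) by blast
qed

lemma line_action_transitive:
  assumes "z \<in> CP2"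
  shows "\<exists>g\<in>SU3. z = line_action g x0"
proof -
  obtain P where "(z, P) \<in> full_flags" using line_extends_to_flag[OF assms] by blast
  from full_flag_eq_image[OF this] show ?thesis
    by (auto simp: flag_action_def line_action_def x0_def)
qed

lemma x0_in_CP2: "x0 \<in> CP2"
  by (simp add: CP2_def x0_def axis_eq_0_iff)

theorem proposition3p12:
  fixes \<rho> :: "complex^3^3 \<Rightarrow> complex^'n^'n"
  assumes "irreducible_unitary_rep \<rho>" and "nontrivial_rep \<rho>"
  shows "(\<forall>\<mu> W. invariant_probability line_action CP2 \<mu> \<longrightarrow>
             symbol_correspondence line_action CP2 \<mu> \<rho> W \<longrightarrow>
             (mapping_positive CP2 W \<longleftrightarrow> is_state (operator_kernel line_action x0 \<rho> W)) \<and>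
             (mapping_positive CP2 W \<longleftrightarrow> positive_op (operator_kernel line_action x0 \<rho> W))) \<and>
         (\<forall>z0 \<mu> W. z0 \<in> full_flags \<longrightarrow> isotropy_group flag_action z0 = diagonal_torus \<longrightarrow>
             invariant_probability flag_action full_flags \<mu> \<longrightarrow>
             symbol_correspondence flag_action full_flags \<mu> \<rho> W \<longrightarrow>
             (mapping_positive full_flags W \<longleftrightarrow> is_state (operator_kernel flag_action z0 \<rho> W)) \<and>
             (mapping_positive full_flags W \<longleftrightarrow> positive_op (operator_kernel flag_action z0 \<rho> W)))"
proof (intro conjI allI impI)
  fix \<mu> and W :: "complex^'n^'n \<Rightarrow> (complex^3) set \<Rightarrow> complex"
  assume "invariant_probability line_action CP2 \<mu>" and "symbol_correspondence line_action CP2 \<mu> \<rho> W"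
  note * = mapping_positive_iff_kernel[OF assms(1) x0_in_CP2 _ line_action_transitive this]
  show "mapping_positive CP2 W \<longleftrightarrow> is_state (operator_kernel line_action x0 \<rho> W)"
    and "mapping_positive CP2 W \<longleftrightarrow> positive_op (operator_kernel line_action x0 \<rho> W)"
    \<comment> \<open>The substantial premise left open is that the identity fixes
      \<open>x0\<close>.\<close>
    by (rule *; simp add: line_action_def)+
next
  fix z0 \<mu> and W :: "complex^'n^'n \<Rightarrow> (complex^3) set \<times> (complex^3) set \<Rightarrow> complex"
  assume z0: "z0 \<in> full_flags"
    and "invariant_probability flag_action full_flags \<mu>"
    and "symbol_correspondence flag_action full_flags \<mu> \<rho> W"
  note * = mapping_positive_iff_kernel[OF assms(1) z0 flag_action_one flag_action_transitive[OF _ z0] this(2,3)]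
  show "mapping_positive full_flags W \<longleftrightarrow> is_state (operator_kernel flag_action z0 \<rho> W)"
    and "mapping_positive full_flags W \<longleftrightarrow> positive_op (operator_kernel flag_action z0 \<rho> W)"
    by (rule *; simp)+
qed

end
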